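(* Let $V,U\ge 0$ be independent random variables, not depending on $\alpha$, with $\mathbb{E}[V]=\mathbb{E}[U]=1$, variances $\sigma_V^2,\sigma_U^2$ satisfying $0<\sigma_V^2+\sigma_U^2<\infty$, and such that for some $\delta>0$ the functions $z\mapsto \mathbb{E}[e^{zV}]$ and $z\mapsto\mathbb{E}[e^{zU}]$ are analytic in an open strip containing $-\delta\le \mathrm{Re}(z)\le\delta$. For $\alpha\in(0,1)$ put $\rho=1-\alpha$, let $W=W_\alpha$ be the steady-state waiting time associated with $V$ and $\frac1\rho U$, and let $\sigma_\alpha^2=(\sigma_V^2+\rho^{-2}\sigma_U^2)\,\rho$. Then for every fixed $k=1,2,\dots$ $$\mathbb{E}\big[(\alpha W)^k\big]=k!\,\big(\tfrac12\sigma_\alpha^2\big)^k+O\big(\alpha\log(1/\alpha)\big),\qquad \alpha\downarrow0 .$$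
   Context: Steady-state waiting time (GI/G/1 queue): $W\ge 0$ is the (finite) random variable whose distribution is the stationary solution of $W\stackrel{d}{=}\big(W+V-\frac1\rho U\big)^+$, where $x^+=\max\{0,x\}$ and on the right-hand side $W,V,U$ are independent; here $\rho\in(0,1)$. *)

theory Defs
  imports "HOL-Probability.Probability" "HOL-Complex_Analysis.Complex_Analysis"
    "HOL-Library.Landau_Symbols"
begin

text \<open>
  \<open>W\<close>, on the probability space \<open>N\<close>, is a steady-state waiting time of the GI/G/1 queue with
  service time \<open>V\<close> and interarrival time \<open>T\<close> (both on \<open>M\<close>): \<open>W\<close> is finite, nonnegative, and its
  law solves \<open>W =\<^sub>d (W + V - T)\<^sup>+\<close>.  The independence of the three variables on the right-hand
  side is expressed by the product of their laws.
\<close>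
definition steady_state_waiting_time ::
    "'b measure \<Rightarrow> ('b \<Rightarrow> real) \<Rightarrow> 'a measure \<Rightarrow> ('a \<Rightarrow> real) \<Rightarrow> ('a \<Rightarrow> real) \<Rightarrow> bool" where
  "steady_state_waiting_time N W M V T \<longleftrightarrow>
     prob_space N \<and> W \<in> borel_measurable N \<and> (AE x in N. 0 \<le> W x) \<and>
     distr N borel W =
       distr (distr N borel W \<Otimes>\<^sub>M (distr M borel V \<Otimes>\<^sub>M distr M borel T)) borel
         (\<lambda>(w, v, t). max 0 (w + v - t))"

text \<open>
  The Bochner integral is \<open>0\<close> for non-integrable functions, so the existence of
  \<open>E[exp(zX)]\<close> throughout the strip is required explicitly.
\<close>
definition mgf_analytic_on_strip :: "'a measure \<Rightarrow> ('a \<Rightarrow> real) \<Rightarrow> real \<Rightarrow> bool" where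
  "mgf_analytic_on_strip M X \<delta> \<longleftrightarrow>
     (\<exists>a b. a < - \<delta> \<and> \<delta> < b \<and>
        (\<forall>z. a < Re z \<and> Re z < b \<longrightarrow> integrable M (\<lambda>x. exp (z * complex_of_real (X x)))) \<and>
        (\<lambda>z. \<integral>x. exp (z * complex_of_real (X x)) \<partial>M) analytic_on {z. a < Re z \<and> Re z < b})"

definition sigma_sq :: "'a measure \<Rightarrow> ('a \<Rightarrow> real) \<Rightarrow> ('a \<Rightarrow> real) \<Rightarrow> real \<Rightarrow> real" where
  "sigma_sq M V U \<alpha> =
     (let \<rho> = 1 - \<alpha>
      in (prob_space.variance M V + (1 / \<rho>)\<^sup>2 * prob_space.variance M U) * \<rho>)"

end

theory Submission
  imports Defs "HOL-Real_Asymp.Real_Asymp"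
begin

text \<open>
  Put \<open>X = V - U/\<rho>\<close>, so that \<open>E X = -\<alpha>/\<rho>\<close>, and \<open>I = min 0 (W + X)\<close>.  Since
  \<open>(max 0 y)\<^sup>n + (min 0 y)\<^sup>n = y\<^sup>n\<close>, stationarity gives
  \<open>\<Sum>\<^sub>j\<^sub>\<ge>\<^sub>1 (n choose j) E[W\<^sup>n\<^sup>-\<^sup>j] E[X\<^sup>j] = E[I\<^sup>n]\<close>.  For \<open>n = k + 1\<close>, after multiplication by
  \<open>\<alpha>\<^sup>k\<^sup>-\<^sup>1\<rho>/(k + 1)\<close>, the terms \<open>j = 1, 2\<close> yield
  \<open>E[(\<alpha>W)\<^sup>k] = k (\<sigma>\<^sub>\<alpha>\<^sup>2/2) E[(\<alpha>W)\<^sup>k\<^sup>-\<^sup>1]\<close> up to \<open>O(\<alpha>)\<close> and the contribution of \<open>E[I\<^sup>k\<^sup>+\<^sup>1]\<close>.  That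
  contribution is \<open>O(\<alpha>)\<close> for \<open>k \<ge> 2\<close>; for \<open>k = 1\<close> it is \<open>O(\<alpha> log (1/\<alpha>))\<close>, because
  \<open>E[-I] = O(\<alpha>)\<close> and \<open>I\<close> has a uniform exponential tail.
\<close>

section \<open>Elementary inequalities for powers and exponentials\<close>

lemma power_le_fact_mult_exp:
  fixes x :: real
  assumes "0 \<le> x"
  shows "x ^ n \<le> fact n * exp x"
proof -
  obtain t where "exp x = (\<Sum>m<Suc n. x ^ m / fact m) + exp t / fact (Suc n) * x ^ Suc n"
    using Maclaurin_exp_le[of x "Suc n"] by blast
  moreover have "0 \<le> (\<Sum>m<n. x ^ m / fact m)"
    using assms by (intro sum_nonneg) auto
  moreover have "0 \<le> exp t / fact (Suc n) * x ^ Suc n"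
    using assms by (intro mult_nonneg_nonneg divide_nonneg_nonneg zero_le_power) auto
  ultimately have "x ^ n / fact n \<le> exp x" by simp
  then show ?thesis by (simp add: field_simps)
qed

text \<open>An arbitrarily small exponent absorbs any power, at the price of the constant. Later
  estimates spend half of an exponent \<open>\<eta>\<close> on a square and keep the other half for
  a second purpose.\<close>

lemma power_le_exp_scaled:
  fixes x :: real
  assumes "0 \<le> x" and "0 < \<theta>"
  shows "x ^ n \<le> fact n / \<theta> ^ n * exp (\<theta> * x)"
proof -
  have "(\<theta> * x) ^ n \<le> fact n * exp (\<theta> * x)"
    using assms by (intro power_le_fact_mult_exp) auto
  then show ?thesis
    using assms by (simp add: field_simps power_mult_distrib)
qed

text \<open>Taylor's formula with Lagrange remainder. The linear term is kept exactly, so that after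
  integration the sign of the mean decides.\<close>

lemma exp_le_quadratic:
  fixes y :: real
  shows "exp y \<le> 1 + y + y\<^sup>2 * exp \<bar>y\<bar>"
proof -
  obtain t where t: "\<bar>t\<bar> \<le> \<bar>y\<bar>" "exp y = (\<Sum>m<2. y ^ m / fact m) + exp t / fact 2 * y ^ 2"
    using Maclaurin_exp_le[of y 2] by blast
  have "exp t \<le> exp \<bar>y\<bar>" using t(1) by simp
  then have "exp t * y\<^sup>2 \<le> y\<^sup>2 * exp \<bar>y\<bar>" by (subst mult.commute) (rule mult_left_mono, auto)
  moreover have "0 \<le> exp t * y\<^sup>2" by simp
  moreover have "exp y = 1 + y + exp t * y\<^sup>2 / 2" using t(2) by (simp add: numeral_2_eq_2)
  ultimately show ?thesis by linarith
qed

text \<open>One of the two bases is 0 and the other is \<open>y\<close>. For \<open>n = 0\<close>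
  the left side would be 2, because \<open>0 ^ 0 = 1\<close>.\<close>

lemma power_max_add_power_min:
  fixes y :: real
  assumes "1 \<le> n"
  shows "max 0 y ^ n + min 0 y ^ n = y ^ n"
  using assms by (cases "0 \<le> y") (auto simp: max_def min_def power_0_left)

section \<open>Consequences of an exponential moment\<close>

lemma (in prob_space) integrable_power_of_exp_abs:
  fixes X :: "'a \<Rightarrow> real"
  assumes [measurable]: "X \<in> borel_measurable M"
    and "0 < \<eta>" and "integrable M (\<lambda>x. exp (\<eta> * \<bar>X x\<bar>))"
  shows "integrable M (\<lambda>x. X x ^ n)"
proof (rule Bochner_Integration.integrable_bound)
  show "integrable M (\<lambda>x. fact n / \<eta> ^ n * exp (\<eta> * \<bar>X x\<bar>))"
    using assms(3) by simp
  show "AE x in M. norm (X x ^ n) \<le> norm (fact n / \<eta> ^ n * exp (\<eta> * \<bar>X x\<bar>))"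
    using power_le_exp_scaled[of "\<bar>X _\<bar>" \<eta> n] assms(2) by (auto simp: power_abs)
qed simp

text \<open>The moment generating function is 1 at 0 and has slope \<open>expectation X < 0\<close>
  there. The proof makes this quantitative: it is at most
  \<open>1 + \<theta> * (expectation X + \<theta> * K)\<close>, which is below 1 for small
  \<open>\<theta>\<close>.\<close>

lemma (in prob_space) negative_mean_imp_mgf_less_1:
  fixes X :: "'a \<Rightarrow> real"
  assumes [measurable]: "X \<in> borel_measurable M"
    and eta: "0 < \<eta>" and int: "integrable M (\<lambda>x. exp (\<eta> * \<bar>X x\<bar>))"
    and neg: "expectation X < 0"
  obtains \<theta> where "0 < \<theta>" "integrable M (\<lambda>x. exp (\<theta> * X x))" "expectation (\<lambda>x. exp (\<theta> * X x)) < 1"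
proof -
  \<comment> \<open>The factor \<open>8 / \<eta>\<^sup>2\<close> is
    \<open>fact 2 / (\<eta>/2)\<^sup>2\<close>: half of \<open>\<eta>\<close> dominates the square.
    The bound \<open>\<theta> \<le> \<eta> / 2\<close> leaves the other half for
    \<open>exp \<bar>\<theta> * X x\<bar>\<close>, and the second entry of the minimum gives
    \<open>\<theta> * K < - expectation X\<close>.\<close>
  define K where "K = 8 / \<eta>\<^sup>2 * expectation (\<lambda>x. exp (\<eta> * \<bar>X x\<bar>))"
  define \<theta> where "\<theta> = min (\<eta> / 2) (- expectation X / (2 * K))"
  have intX: "integrable M X"
    using integrable_power_of_exp_abs[OF _ eta int, of 1] by simp
  have "1 \<le> expectation (\<lambda>x. exp (\<eta> * \<bar>X x\<bar>))"
    using eta by (intro integral_ge_const int) auto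
  then have K: "0 < K" using eta by (auto simp: K_def)
  have th: "0 < \<theta>" "\<theta> \<le> \<eta> / 2" using eta K neg by (auto simp: \<theta>_def divide_neg_pos)
  have "\<theta> \<le> - expectation X / (2 * K)" by (simp add: \<theta>_def)
  then have "\<theta> * K \<le> - expectation X / 2" using K by (simp add: field_simps)
  then have th2: "\<theta> * K < - expectation X" using neg by linarith
  have le: "exp (\<theta> * X x) \<le> 1 + \<theta> * X x + \<theta>\<^sup>2 * (8 / \<eta>\<^sup>2) * exp (\<eta> * \<bar>X x\<bar>)" for x
  proof -
    have "\<bar>X x\<bar> ^ 2 \<le> fact 2 / (\<eta>/2) ^ 2 * exp (\<eta>/2 * \<bar>X x\<bar>)"
      using eta by (intro power_le_exp_scaled) auto
    then have 1: "(X x)\<^sup>2 \<le> 8 / \<eta>\<^sup>2 * exp (\<eta>/2 * \<bar>X x\<bar>)"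
      by (simp add: power_divide)
    have 2: "exp \<bar>\<theta> * X x\<bar> \<le> exp (\<eta>/2 * \<bar>X x\<bar>)"
      using th mult_right_mono[OF th(2), of "\<bar>X x\<bar>"] by (simp add: abs_mult)
    have "(X x)\<^sup>2 * exp \<bar>\<theta> * X x\<bar> \<le> (8 / \<eta>\<^sup>2 * exp (\<eta>/2 * \<bar>X x\<bar>)) * exp (\<eta>/2 * \<bar>X x\<bar>)"
      by (intro mult_mono 1 2) auto
    also have "\<dots> = 8 / \<eta>\<^sup>2 * exp (\<eta> * \<bar>X x\<bar>)"
      by (simp add: mult_exp_exp)
    finally have "\<theta>\<^sup>2 * ((X x)\<^sup>2 * exp \<bar>\<theta> * X x\<bar>) \<le> \<theta>\<^sup>2 * (8 / \<eta>\<^sup>2 * exp (\<eta> * \<bar>X x\<bar>))"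
      by (intro mult_left_mono) auto
    then show ?thesis
      using exp_le_quadratic[of "\<theta> * X x"] by (simp add: power_mult_distrib mult.assoc)
  qed
  have bd: "integrable M (\<lambda>x. 1 + \<theta> * X x + \<theta>\<^sup>2 * (8 / \<eta>\<^sup>2) * exp (\<eta> * \<bar>X x\<bar>))"
    using intX int by (intro Bochner_Integration.integrable_add) auto
  have ie: "integrable M (\<lambda>x. exp (\<theta> * X x))"
    by (rule Bochner_Integration.integrable_bound[OF bd])
       (auto intro!: AE_I2 order_trans[OF le abs_ge_self] simp del: times_divide_eq_right)
  have "expectation (\<lambda>x. exp (\<theta> * X x))
        \<le> expectation (\<lambda>x. 1 + \<theta> * X x + \<theta>\<^sup>2 * (8 / \<eta>\<^sup>2) * exp (\<eta> * \<bar>X x\<bar>))"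
    by (intro integral_mono ie bd le)
  also have "\<dots> = 1 + \<theta> * (expectation X + \<theta> * K)"
    using intX int by (simp add: K_def prob_space algebra_simps power2_eq_square)
  also have "\<dots> < 1" using th th2 by (simp add: mult_pos_neg)
  finally show ?thesis using that th ie by blast
qed

section \<open>The stationary Lindley recursion and exponential moments of its solution\<close>

text \<open>Only the increment, service time minus interarrival time, enters the recursion. Working
  on the product of \<open>N\<close> and \<open>M\<close> makes \<open>W\<close> and
  \<open>X\<close> independent by construction and turns expectations into iterated
  integrals.\<close>

locale lindley_stationary = N: prob_space N + M: prob_space M
  for N :: "'b measure" and M :: "'a measure" +
  fixes W :: "'b \<Rightarrow> real" and X :: "'a \<Rightarrow> real"
  assumes W_meas [measurable]: "W \<in> borel_measurable N"
    and X_meas [measurable]: "X \<in> borel_measurable M"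
    and W_nonneg: "AE w in N. 0 \<le> W w"
    and stationary: "distr N borel W = distr (N \<Otimes>\<^sub>M M) borel (\<lambda>z. max 0 (W (fst z) + X (snd z)))"
begin

sublocale P: pair_prob_space N M ..

lemma integral_stationary:
  fixes f :: "real \<Rightarrow> real"
  assumes [measurable]: "f \<in> borel_measurable borel"
  shows "(\<integral>w. f (W w) \<partial>N) = (\<integral>z. f (max 0 (W (fst z) + X (snd z))) \<partial>(N \<Otimes>\<^sub>M M))"
proof -
  have "(\<integral>w. f (W w) \<partial>N) = (\<integral>y. f y \<partial>distr N borel W)" by (simp add: integral_distr)
  also have "\<dots> = (\<integral>z. f (max 0 (W (fst z) + X (snd z))) \<partial>(N \<Otimes>\<^sub>M M))"
    unfolding stationary by (simp add: integral_distr)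
  finally show ?thesis .
qed

lemma integrable_stationary:
  fixes f :: "real \<Rightarrow> real"
  assumes [measurable]: "f \<in> borel_measurable borel" and "integrable N (\<lambda>w. f (W w))"
  shows "integrable (N \<Otimes>\<^sub>M M) (\<lambda>z. f (max 0 (W (fst z) + X (snd z))))"
proof -
  have "integrable (distr N borel W) f" using assms by (simp add: integrable_distr_eq)
  then show ?thesis unfolding stationary by (simp add: integrable_distr_eq)
qed

text \<open>Testing stationarity with \<open>min (exp (\<theta>w)) (exp (\<theta>n))\<close>, which is bounded, yields a bound that does
  not depend on \<open>n\<close>, without assuming any moment of \<open>W\<close>.\<close>
lemma truncated_exp_bound:
  assumes th: "0 < \<theta>" and int: "integrable M (\<lambda>x. exp (\<theta> * X x))"
    and phi: "M.expectation (\<lambda>x. exp (\<theta> * X x)) < 1"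
  shows "N.expectation (\<lambda>w. exp (\<theta> * W w) * indicator {w. W w < real n} w)
         \<le> 1 / (1 - M.expectation (\<lambda>x. exp (\<theta> * X x)))"
proof -
  define \<phi> where "\<phi> = M.expectation (\<lambda>x. exp (\<theta> * X x))"
  define f where "f w = min (exp (\<theta> * w)) (exp (\<theta> * real n))" for w
  define g where "g w = exp (\<theta> * W w) * indicator {w. W w < real n} w" for w
  have [measurable]: "f \<in> borel_measurable borel" unfolding f_def by measurable
  have [measurable]: "g \<in> borel_measurable N" unfolding g_def by measurable
  have fb: "0 \<le> f w" "f w \<le> exp (\<theta> * real n)" for w by (auto simp: f_def)
  have f_int: "integrable N (\<lambda>w. f (W w))"
    by (rule N.integrable_const_bound[of _ "exp (\<theta> * real n)"]) (auto simp: fb)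
  have h_int: "integrable (N \<Otimes>\<^sub>M M) (\<lambda>z. f (max 0 (W (fst z) + X (snd z))))"
    by (rule integrable_stationary[OF _ f_int]) simp
  have g_int: "integrable N g"
    by (rule N.integrable_const_bound[of _ "exp (\<theta> * real n)"])
       (use th in \<open>auto simp: g_def indicator_def\<close>)
  have inner_int: "integrable M (\<lambda>x. f (max 0 (W w + X x)))" for w
    by (rule M.integrable_const_bound[of _ "exp (\<theta> * real n)"]) (auto simp: fb)
  \<comment> \<open>A drift inequality. Below level \<open>n\<close>, the bound
    \<open>exp (max 0 y) \<le> 1 + exp y\<close> shows that one step multiplies the exponential by
    at most \<open>\<phi>\<close> in the mean, up to an additive 1 caused by the reflection at 0.
    Above level \<open>n\<close>, \<open>f\<close> already has its maximal value, so a step cannot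
    increase it.\<close>
  have inner: "(\<integral>x. f (max 0 (W w + X x)) \<partial>M) \<le> f (W w) + 1 - (1 - \<phi>) * g w" for w
  proof (cases "W w < real n")
    case True
    have "(\<integral>x. f (max 0 (W w + X x)) \<partial>M) \<le> (\<integral>x. 1 + exp (\<theta> * W w) * exp (\<theta> * X x) \<partial>M)"
    proof (intro integral_mono inner_int)
      show "f (max 0 (W w + X x)) \<le> 1 + exp (\<theta> * W w) * exp (\<theta> * X x)" for x
        unfolding f_def
        by (rule min.coboundedI1) (auto simp: max_def mult_exp_exp algebra_simps)
    qed (use int in auto)
    also have "\<dots> = 1 + exp (\<theta> * W w) * \<phi>"
      using int by (simp add: \<phi>_def M.prob_space)
    also have "exp (\<theta> * W w) = f (W w)" using True th by (simp add: f_def)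
    finally show ?thesis using True th by (simp add: f_def g_def algebra_simps)
  next
    case False
    then have "f (W w) = exp (\<theta> * real n)" using th by (simp add: f_def)
    then have "(\<integral>x. f (max 0 (W w + X x)) \<partial>M) \<le> f (W w)"
      using fb by (intro M.integral_le_const inner_int) auto
    then show ?thesis using False by (simp add: g_def)
  qed
  \<comment> \<open>By stationarity the integral of \<open>f (W w)\<close> stands on both sides of
    the integrated drift inequality. It is finite because \<open>f\<close> is bounded, so it cancels
    and leaves a bound on the integral of \<open>g\<close>.\<close>
  have "(\<integral>w. f (W w) \<partial>N) = (\<integral>w. (\<integral>x. f (max 0 (W w + X x)) \<partial>M) \<partial>N)"
    using P.integral_fst'[OF h_int] by (simp add: integral_stationary)
  also have "\<dots> \<le> (\<integral>w. f (W w) + 1 - (1 - \<phi>) * g w \<partial>N)"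
    using P.integrable_fst'[OF h_int] f_int g_int inner by (intro integral_mono) auto
  also have "\<dots> = (\<integral>w. f (W w) \<partial>N) + 1 - (1 - \<phi>) * (\<integral>w. g w \<partial>N)"
    using f_int g_int by (simp add: N.prob_space)
  finally have "(1 - \<phi>) * (\<integral>w. g w \<partial>N) \<le> 1" by simp
  then show ?thesis using phi by (simp add: g_def \<phi>_def field_simps)
qed

text \<open>Monotone convergence as the truncation level rises: the bound of
  \<open>truncated_exp_bound\<close> is uniform in \<open>n\<close>, and at each point the
  truncation is eventually inactive.\<close>

lemma integrable_exp_W:
  assumes "0 < \<theta>" and "integrable M (\<lambda>x. exp (\<theta> * X x))"
    and "M.expectation (\<lambda>x. exp (\<theta> * X x)) < 1"
  shows "integrable N (\<lambda>w. exp (\<theta> * W w))"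
proof -
  define g where "g n w = exp (\<theta> * W w) * indicator {w. W w < real n} w" for n w
  define C where "C = 1 / (1 - M.expectation (\<lambda>x. exp (\<theta> * X x)))"
  have [measurable]: "g n \<in> borel_measurable N" for n unfolding g_def by measurable
  have g_int: "integrable N (g n)" for n
    by (rule N.integrable_const_bound[of _ "exp (\<theta> * real n)"])
       (use assms in \<open>auto simp: g_def indicator_def\<close>)
  have g_bound: "integral\<^sup>L N (g n) \<le> C" for n
    unfolding g_def C_def by (rule truncated_exp_bound[OF assms])
  have g_mono: "mono (\<lambda>n. g n w)" for w
    by (rule monoI) (auto simp: g_def indicator_def)
  have "incseq (\<lambda>n. integral\<^sup>L N (g n))"
    using g_mono by (intro monoI integral_mono g_int) (auto dest: monoD)
  then obtain x where x: "(\<lambda>n. integral\<^sup>L N (g n)) \<longlonglongrightarrow> x"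
    using g_bound incseq_convergent by metis
  show ?thesis
  proof (rule integrable_monotone_convergence[OF g_int _ _ x])
    show "AE w in N. (\<lambda>n. g n w) \<longlonglongrightarrow> exp (\<theta> * W w)"
    proof (rule AE_I2, rule tendsto_eventually)
      fix w
      obtain m :: nat where "W w < real m" using reals_Archimedean2 by blast
      then show "\<forall>\<^sub>F n in sequentially. g n w = exp (\<theta> * W w)"
        by (auto simp: g_def eventually_sequentially intro!: exI[of _ m])
    qed
  qed (use g_mono in auto)
qed

lemma AE_W_nonneg_pair: "AE z in N \<Otimes>\<^sub>M M. 0 \<le> W (fst z)"
proof -
  have "{w \<in> space N. 0 \<le> W w} \<in> sets N" by measurable
  then show ?thesis
    using W_nonneg by (intro P.AE_pair_measure) auto
qed

section \<open>Moment identity and overshoot estimates under negative drift\<close>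

context
  fixes \<eta> :: real
  assumes eta: "0 < \<eta>" and exp_int: "integrable M (\<lambda>x. exp (\<eta> * \<bar>X x\<bar>))"
    and drift: "M.expectation X < 0"
begin

lemma integrable_X_power: "integrable M (\<lambda>x. X x ^ n)"
  by (rule M.integrable_power_of_exp_abs[OF X_meas eta exp_int])

text \<open>Finiteness of the moments is derived, not assumed: negative drift supplies a
  \<open>\<theta>\<close> at which the moment generating function of \<open>X\<close> is below 1,
  and then \<open>W\<close> has an exponential moment.\<close>

lemma integrable_W_power: "integrable N (\<lambda>w. W w ^ n)"
proof -
  obtain \<theta> where th: "0 < \<theta>" and "integrable M (\<lambda>x. exp (\<theta> * X x))"
    "M.expectation (\<lambda>x. exp (\<theta> * X x)) < 1"
    using M.negative_mean_imp_mgf_less_1[OF X_meas eta exp_int drift] .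
  then have int: "integrable N (\<lambda>w. exp (\<theta> * W w))" by (rule integrable_exp_W)
  have "AE w in N. exp (\<theta> * \<bar>W w\<bar>) = exp (\<theta> * W w)"
    using W_nonneg by eventually_elim simp
  then have "integrable N (\<lambda>w. exp (\<theta> * \<bar>W w\<bar>))"
    using int by (subst integrable_cong_AE) auto
  then show ?thesis by (rule N.integrable_power_of_exp_abs[OF W_meas th])
qed

text \<open>The part of the step that the reflection at 0 cuts off; its negative is the idle time of
  the server.\<close>

abbreviation overshoot :: "'b \<times> 'a \<Rightarrow> real" where
  "overshoot z \<equiv> min 0 (W (fst z) + X (snd z))"

lemma integrable_W_power_X_power:
  "integrable (N \<Otimes>\<^sub>M M) (\<lambda>z. W (fst z) ^ i * X (snd z) ^ j)"
  and integral_W_power_X_power: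
  "(\<integral>z. W (fst z) ^ i * X (snd z) ^ j \<partial>(N \<Otimes>\<^sub>M M)) = (\<integral>w. W w ^ i \<partial>N) * (\<integral>x. X x ^ j \<partial>M)"
proof -
  show *: "integrable (N \<Otimes>\<^sub>M M) (\<lambda>z. W (fst z) ^ i * X (snd z) ^ j)"
    using integrable_W_power[of i] integrable_X_power[of j]
    by (intro P.Fubini_integrable) (auto simp: abs_mult)
  show "(\<integral>z. W (fst z) ^ i * X (snd z) ^ j \<partial>(N \<Otimes>\<^sub>M M)) = (\<integral>w. W w ^ i \<partial>N) * (\<integral>x. X x ^ j \<partial>M)"
    using P.integral_fst'[OF *] by simp
qed

text \<open>In the binomial expansion of \<open>(W + X) ^ n\<close> the term \<open>j = 0\<close> is
  the n-th moment of \<open>W\<close>. By stationarity the reflected value has the same n-th moment,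
  and since it is finite the two cancel.\<close>

lemma moment_identity:
  assumes n: "1 \<le> n"
  shows "(\<Sum>j=1..n. real (n choose j) * (\<integral>w. W w ^ (n - j) \<partial>N) * (\<integral>x. X x ^ j \<partial>M))
         = (\<integral>z. overshoot z ^ n \<partial>(N \<Otimes>\<^sub>M M))"
proof -
  let ?t = "\<lambda>j z. real (n choose j) * (W (fst z) ^ (n - j) * X (snd z) ^ j)"
  have expand: "(W (fst z) + X (snd z)) ^ n = (\<Sum>j\<le>n. ?t j z)" for z
    using binomial_ring[of "X (snd z)" "W (fst z)" n]
    by (simp add: mult_ac add.commute[of "X _"])
  have sum_int: "integrable (N \<Otimes>\<^sub>M M) (\<lambda>z. \<Sum>j\<le>n. ?t j z)"
    using integrable_W_power_X_power by (intro Bochner_Integration.integrable_sum) auto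
  have max_int: "integrable (N \<Otimes>\<^sub>M M) (\<lambda>z. max 0 (W (fst z) + X (snd z)) ^ n)"
    using integrable_W_power by (intro integrable_stationary) auto
  have "(\<integral>z. overshoot z ^ n \<partial>(N \<Otimes>\<^sub>M M))
      = (\<integral>z. (\<Sum>j\<le>n. ?t j z) - max 0 (W (fst z) + X (snd z)) ^ n \<partial>(N \<Otimes>\<^sub>M M))"
    using power_max_add_power_min[OF n, of "W (fst _) + X (snd _)"]
    by (intro Bochner_Integration.integral_cong) (auto simp: expand[symmetric] eq_diff_eq add.commute)
  also have "\<dots> = (\<integral>z. (\<Sum>j\<le>n. ?t j z) \<partial>(N \<Otimes>\<^sub>M M)) - (\<integral>w. W w ^ n \<partial>N)"
    using sum_int max_int integral_stationary[of "\<lambda>y. y ^ n"] by simp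
  also have "(\<integral>z. (\<Sum>j\<le>n. ?t j z) \<partial>(N \<Otimes>\<^sub>M M))
      = (\<Sum>j\<le>n. real (n choose j) * (\<integral>w. W w ^ (n - j) \<partial>N) * (\<integral>x. X x ^ j \<partial>M))"
    using integrable_W_power_X_power
    by (subst Bochner_Integration.integral_sum) (auto simp: integral_W_power_X_power mult.assoc)
  also have "\<dots> = (\<integral>w. W w ^ n \<partial>N)
      + (\<Sum>j=1..n. real (n choose j) * (\<integral>w. W w ^ (n - j) \<partial>N) * (\<integral>x. X x ^ j \<partial>M))"
    by (simp add: atMost_atLeast0 sum.atLeast_Suc_atMost M.prob_space)
  finally show ?thesis by simp
qed

text \<open>Since \<open>W\<close> is nonnegative, the overshoot lies between \<open>min 0 X\<close>
  and 0. Hence tail and moment bounds pass from \<open>X\<close> to the overshoot without reference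
  to the law of \<open>W\<close>.\<close>

lemma AE_overshoot_le: "AE z in N \<Otimes>\<^sub>M M. \<bar>overshoot z\<bar> \<le> \<bar>X (snd z)\<bar>"
  using AE_W_nonneg_pair by eventually_elim auto

lemma integrable_of_X:
  fixes f :: "real \<Rightarrow> real"
  assumes [measurable]: "f \<in> borel_measurable borel" and "integrable M (\<lambda>x. f (X x))"
  shows "integrable (N \<Otimes>\<^sub>M M) (\<lambda>z. f (X (snd z)))"
    and "(\<integral>z. f (X (snd z)) \<partial>(N \<Otimes>\<^sub>M M)) = (\<integral>x. f (X x) \<partial>M)"
proof -
  show *: "integrable (N \<Otimes>\<^sub>M M) (\<lambda>z. f (X (snd z)))"
    using assms by (intro P.Fubini_integrable) auto
  show "(\<integral>z. f (X (snd z)) \<partial>(N \<Otimes>\<^sub>M M)) = (\<integral>x. f (X x) \<partial>M)"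
    using P.integral_fst'[OF *] by (simp add: N.prob_space)
qed

lemma integrable_overshoot_power: "integrable (N \<Otimes>\<^sub>M M) (\<lambda>z. overshoot z ^ n)"
proof (rule Bochner_Integration.integrable_bound)
  show "integrable (N \<Otimes>\<^sub>M M) (\<lambda>z. X (snd z) ^ n)"
    using integrable_X_power by (intro integrable_of_X) auto
  show "AE z in N \<Otimes>\<^sub>M M. norm (overshoot z ^ n) \<le> norm (X (snd z) ^ n)"
    using AE_overshoot_le by eventually_elim (simp add: power_abs power_mono)
qed simp

lemma overshoot_moment_bound:
  "\<bar>\<integral>z. overshoot z ^ n \<partial>(N \<Otimes>\<^sub>M M)\<bar> \<le> (\<integral>x. \<bar>X x\<bar> ^ n \<partial>M)"
proof -
  have int: "integrable M (\<lambda>x. \<bar>X x\<bar> ^ n)"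
    using integrable_abs[OF integrable_X_power] by (simp add: power_abs)
  have "\<bar>\<integral>z. overshoot z ^ n \<partial>(N \<Otimes>\<^sub>M M)\<bar> \<le> (\<integral>z. \<bar>overshoot z ^ n\<bar> \<partial>(N \<Otimes>\<^sub>M M))"
    by (rule integral_abs_bound)
  also have "\<dots> \<le> (\<integral>z. \<bar>X (snd z)\<bar> ^ n \<partial>(N \<Otimes>\<^sub>M M))"
  proof (rule integral_mono_AE)
    show "AE z in N \<Otimes>\<^sub>M M. \<bar>overshoot z ^ n\<bar> \<le> \<bar>X (snd z)\<bar> ^ n"
      using AE_overshoot_le by eventually_elim (simp add: power_abs power_mono)
    show "integrable (N \<Otimes>\<^sub>M M) (\<lambda>z. \<bar>X (snd z)\<bar> ^ n)"
      using int by (intro integrable_of_X) auto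
  qed (use integrable_overshoot_power in auto)
  also have "\<dots> = (\<integral>x. \<bar>X x\<bar> ^ n \<partial>M)"
    using int by (intro integrable_of_X) auto
  finally show ?thesis .
qed

text \<open>The overshoot has mean \<open>E X\<close>, which is small, and an exponential tail inherited from \<open>X\<close>;
  cutting at level \<open>L\<close> trades the one against the other.\<close>
lemma overshoot_second_moment_bound:
  assumes L: "0 \<le> L"
  shows "(\<integral>z. overshoot z ^ 2 \<partial>(N \<Otimes>\<^sub>M M))
         \<le> L * (- M.expectation X)
           + 8 / \<eta>\<^sup>2 * exp (- (\<eta> * L / 2)) * M.expectation (\<lambda>x. exp (\<eta> * \<bar>X x\<bar>))"
proof -
  let ?c = "8 / \<eta>\<^sup>2 * exp (- (\<eta> * L / 2))"
  \<comment> \<open>For \<open>n = 1\<close> the identity consists of the single term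
    \<open>j = 1\<close>, with the zeroth moment of \<open>W\<close> as its factor.\<close>
  have mean: "(\<integral>z. overshoot z \<partial>(N \<Otimes>\<^sub>M M)) = M.expectation X"
    using moment_identity[of 1] by (simp add: N.prob_space)
  have o_int: "integrable (N \<Otimes>\<^sub>M M) overshoot"
    using integrable_overshoot_power[of 1] by simp
  have e_int: "integrable (N \<Otimes>\<^sub>M M) (\<lambda>z. exp (\<eta> * \<bar>X (snd z)\<bar>))"
    using exp_int by (intro integrable_of_X) auto
  \<comment> \<open>If \<bar>i\<bar> is at most \<open>L\<close>, one factor of the square is
    replaced by \<open>L\<close>. Otherwise half of \<open>\<eta>\<close> dominates the square, and
    \<bar>x\<bar> > \<open>L\<close> turns the other half into the gain
    \<open>exp (- (\<eta> * L / 2))\<close>.\<close>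
  have pt: "i\<^sup>2 \<le> L * (- i) + ?c * exp (\<eta> * \<bar>x\<bar>)" if "i \<le> 0" "\<bar>i\<bar> \<le> \<bar>x\<bar>" for i x :: real
  proof (cases "\<bar>i\<bar> \<le> L")
    case True
    then have "\<bar>i\<bar> * \<bar>i\<bar> \<le> L * \<bar>i\<bar>" by (intro mult_right_mono) auto
    moreover have "0 \<le> ?c * exp (\<eta> * \<bar>x\<bar>)" by simp
    moreover have "\<bar>i\<bar> * \<bar>i\<bar> = i\<^sup>2" by (simp add: power2_eq_square)
    moreover have "\<bar>i\<bar> = - i" using that by simp
    ultimately show ?thesis by (metis add_increasing2)
  next
    case False
    have "i\<^sup>2 \<le> \<bar>x\<bar> ^ 2" using that(2) by (simp add: abs_le_square_iff)
    also have "\<dots> \<le> fact 2 / (\<eta>/2) ^ 2 * exp (\<eta>/2 * \<bar>x\<bar>)"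
      using eta by (intro power_le_exp_scaled) auto
    also have "\<dots> = 8 / \<eta>\<^sup>2 * exp (\<eta>/2 * \<bar>x\<bar>)"
      by (simp add: power_divide)
    also have "\<dots> \<le> 8 / \<eta>\<^sup>2 * exp (\<eta> * \<bar>x\<bar> - \<eta> * L / 2)"
    proof -
      have "\<eta> * L \<le> \<eta> * \<bar>x\<bar>" using False that eta by (intro mult_left_mono) auto
      then show ?thesis by (intro mult_left_mono) auto
    qed
    also have "\<dots> = ?c * exp (\<eta> * \<bar>x\<bar>)"
      by (simp add: mult_exp_exp)
    also have "\<dots> \<le> L * (- i) + ?c * exp (\<eta> * \<bar>x\<bar>)"
      using L that(1) mult_nonneg_nonneg[of L "- i"] by simp
    finally show ?thesis .
  qed
  have "(\<integral>z. overshoot z ^ 2 \<partial>(N \<Otimes>\<^sub>M M))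
      \<le> (\<integral>z. L * (- overshoot z) + ?c * exp (\<eta> * \<bar>X (snd z)\<bar>) \<partial>(N \<Otimes>\<^sub>M M))"
  proof (rule integral_mono_AE)
    show "AE z in N \<Otimes>\<^sub>M M. overshoot z ^ 2 \<le> L * (- overshoot z) + ?c * exp (\<eta> * \<bar>X (snd z)\<bar>)"
      using AE_overshoot_le
    proof eventually_elim
      case (elim z)
      then show ?case by (intro pt) auto
    qed
    show "integrable (N \<Otimes>\<^sub>M M) (\<lambda>z. L * (- overshoot z) + ?c * exp (\<eta> * \<bar>X (snd z)\<bar>))"
      using o_int e_int by (intro Bochner_Integration.integrable_add integrable_mult_right) auto
  qed (rule integrable_overshoot_power)
  also have "\<dots> = L * (- (\<integral>z. overshoot z \<partial>(N \<Otimes>\<^sub>M M)))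
      + ?c * (\<integral>z. exp (\<eta> * \<bar>X (snd z)\<bar>) \<partial>(N \<Otimes>\<^sub>M M))"
    using o_int e_int by (subst Bochner_Integration.integral_add) auto
  also have "(\<integral>z. exp (\<eta> * \<bar>X (snd z)\<bar>) \<partial>(N \<Otimes>\<^sub>M M)) = M.expectation (\<lambda>x. exp (\<eta> * \<bar>X x\<bar>))"
    using exp_int by (intro integrable_of_X) auto
  finally show ?thesis unfolding mean .
qed

end

end

section \<open>Asymptotic solution of the moment recurrence\<close>

text \<open>Separates the asymptotics from the probability: in the application \<open>m\<close>,
  \<open>x\<close>, \<open>r\<close> are the moments of waiting time, increment and overshoot, and
  \<open>s\<close> is half of \<open>sigma_sq\<close>. The identity of order \<open>k + 1\<close>,
  solved for \<open>m k\<close>, involves all lower moments, hence the strong induction.\<close>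

lemma heavy_traffic_recurrence_asymp:
  fixes m x r :: "nat \<Rightarrow> real \<Rightarrow> real" and s :: "real \<Rightarrow> real"
  defines "g \<equiv> \<lambda>\<alpha>. \<alpha> * ln (1 / \<alpha>)"
  assumes m0: "\<forall>\<^sub>F \<alpha> in at_right 0. m 0 \<alpha> = 1"
    and x1: "\<forall>\<^sub>F \<alpha> in at_right 0. x 1 \<alpha> = - \<alpha> / (1 - \<alpha>)"
    and x2: "\<forall>\<^sub>F \<alpha> in at_right 0. (1 - \<alpha>) * x 2 \<alpha> = 2 * s \<alpha> + \<alpha>\<^sup>2 / (1 - \<alpha>)"
    and x_bdd: "\<And>j. x j \<in> O[at_right 0](\<lambda>_. 1)"
    and r_bdd: "\<And>n. r n \<in> O[at_right 0](\<lambda>_. 1)"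
    and r2: "r 2 \<in> O[at_right 0](g)"
    and s_bdd: "s \<in> O[at_right 0](\<lambda>_. 1)"
    and identity: "\<And>n. 1 \<le> n \<Longrightarrow>
      \<forall>\<^sub>F \<alpha> in at_right 0. (\<Sum>j=1..n. real (n choose j) * m (n - j) \<alpha> * x j \<alpha>) = r n \<alpha>"
  shows "(\<lambda>\<alpha>. \<alpha> ^ k * m k \<alpha> - fact k * s \<alpha> ^ k) \<in> O[at_right 0](g)"
proof (induction k rule: less_induct)
  case (less k)
  have g1: "g \<in> O[at_right 0](\<lambda>_. 1)" unfolding g_def by real_asymp
  have ag: "(\<lambda>\<alpha>. \<alpha>) \<in> O[at_right 0](g)" unfolding g_def by real_asymp
  have pow1: "(\<lambda>\<alpha>. \<alpha> ^ i) \<in> O[at_right 0](\<lambda>_. 1 :: real)" for i :: nat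
  proof -
    have "(\<lambda>\<alpha>::real. \<alpha>) \<in> O[at_right 0](\<lambda>_. 1)" by real_asymp
    from landau_o.big_power[OF this, of i] show ?thesis by simp
  qed
  have s_pow: "(\<lambda>\<alpha>. c * s \<alpha> ^ i) \<in> O[at_right 0](\<lambda>_. 1)" for c :: real and i :: nat
    using landau_o.big_power[OF s_bdd, of i] by simp
  have pow_g: "(\<lambda>\<alpha>. \<alpha> ^ i) \<in> O[at_right 0](g)" if "1 \<le> i" for i :: nat
  proof -
    have "(\<lambda>\<alpha>. \<alpha> * \<alpha> ^ (i - 1)) \<in> O[at_right 0](\<lambda>\<alpha>. g \<alpha> * 1)"
      by (intro landau_o.big.mult ag pow1)
    then show ?thesis using that by (cases i) auto
  qed
  define e where "e j \<alpha> = \<alpha> ^ j * m j \<alpha>" for j \<alpha>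
  have e_asymp: "(\<lambda>\<alpha>. e j \<alpha> - fact j * s \<alpha> ^ j) \<in> O[at_right 0](g)" if "j < k" for j
    using less.IH[OF that] by (simp add: e_def)
  have e_bdd: "e j \<in> O[at_right 0](\<lambda>_. 1)" if "j < k" for j
  proof -
    have "(\<lambda>\<alpha>. (e j \<alpha> - fact j * s \<alpha> ^ j) + fact j * s \<alpha> ^ j) \<in> O[at_right 0](\<lambda>_. 1)"
      by (intro sum_in_bigo(1) s_pow landau_o.big_trans[OF e_asymp[OF that] g1])
    then show ?thesis by simp
  qed
  show ?case
  proof (cases "k = 0")
    case True
    have "\<forall>\<^sub>F \<alpha> in at_right 0. \<alpha> ^ k * m k \<alpha> - fact k * s \<alpha> ^ k = 0"
      using m0 by eventually_elim (simp add: True)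
    then show ?thesis by (rule landau_o.big.in_cong[THEN iffD2]) simp
  next
    case False
    then obtain l where k: "k = Suc l" by (cases k) auto
    \<comment> \<open>Of the \<open>l = k - 1\<close> factors \<alpha> available, the moment of
      order \<open>Suc k - j\<close> takes up that many, which leaves \<open>j - 2\<close>. For
      \<open>j \<ge> 3\<close> at least one remains, so every summand is small.\<close>
    define rest where "rest \<alpha> = (\<Sum>j=3..Suc k. real (Suc k choose j) * \<alpha> ^ (j - 2) * e (Suc k - j) \<alpha> * x j \<alpha>)" for \<alpha>
    define err where "err \<alpha> = real k / 2 * (\<alpha>\<^sup>2 / (1 - \<alpha>)) * e l \<alpha>
        + (1 - \<alpha>) / real (Suc k) * (rest \<alpha> - \<alpha> ^ l * r (Suc k) \<alpha>)" for \<alpha>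
    \<comment> \<open>The identity for \<open>n = Suc k\<close> is multiplied by
      \<open>(1 - \<alpha>) * \<alpha> ^ l / Suc k\<close>. By \<open>x1\<close> the term
      \<open>j = 1\<close> becomes \<open>- e k\<close>; by \<open>x2\<close> the term
      \<open>j = 2\<close> gives the main term and the first summand of \<open>err\<close>.\<close>
    have rec: "\<forall>\<^sub>F \<alpha> in at_right 0. e k \<alpha> = real k * s \<alpha> * e l \<alpha> + err \<alpha>"
    proof -
      have "1 \<le> Suc k" by simp
      from identity[OF this] x1 x2 have ev: "\<forall>\<^sub>F \<alpha> in at_right 0.
          (\<Sum>j=1..Suc k. real (Suc k choose j) * m (Suc k - j) \<alpha> * x j \<alpha>) = r (Suc k) \<alpha> \<and>
          x 1 \<alpha> = - \<alpha> / (1 - \<alpha>) \<and> (1 - \<alpha>) * x 2 \<alpha> = 2 * s \<alpha> + \<alpha>\<^sup>2 / (1 - \<alpha>)"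
        by eventually_elim blast
      have "\<forall>\<^sub>F \<alpha>::real in at_right 0. 0 < \<alpha> \<and> \<alpha> < 1"
        by (rule eventually_at_rightI[of 0 1]) auto
      with ev show ?thesis
      proof eventually_elim
        case (elim \<alpha>)
        then have nz: "1 - \<alpha> \<noteq> 0" by simp
        have choose2: "real (Suc k choose 2) = real (Suc k) * real k / 2"
          using arg_cong[OF Suc_times_binomial[of 1 k], of real]
          by (simp add: numeral_2_eq_2 algebra_simps)
        let ?f = "\<lambda>j. real (Suc k choose j) * m (Suc k - j) \<alpha> * x j \<alpha>"
        have split: "(\<Sum>j=1..Suc k. ?f j) = ?f 1 + (?f 2 + (\<Sum>j=3..Suc k. ?f j))"
          using k by (simp add: sum.atLeast_Suc_atMost numeral_2_eq_2 numeral_3_eq_3 del: binomial_Suc_Suc sum.cl_ivl_Suc)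
        have f1: "?f 1 = real (Suc k) * m k \<alpha> * x 1 \<alpha>" by simp
        have f2: "?f 2 = real (Suc k) * real k / 2 * m l \<alpha> * x 2 \<alpha>"
          unfolding choose2 by (simp add: k)
        have expanded: "real (Suc k) * m k \<alpha> * x 1 \<alpha>
            + (real (Suc k) * real k / 2 * m l \<alpha> * x 2 \<alpha> + (\<Sum>j=3..Suc k. ?f j)) = r (Suc k) \<alpha>"
          using elim unfolding split f1 f2 by blast
        have sum_eq: "\<alpha> ^ l * (\<Sum>j=3..Suc k. ?f j) = rest \<alpha>"
          unfolding rest_def sum_distrib_left
        proof (intro sum.cong refl)
          fix j assume j: "j \<in> {3..Suc k}"
          then have "l = (j - 2) + (Suc k - j)" using k by auto
          then have "\<alpha> ^ l = \<alpha> ^ (j - 2) * \<alpha> ^ (Suc k - j)" by (metis power_add)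
          then show "\<alpha> ^ l * ?f j = real (Suc k choose j) * \<alpha> ^ (j - 2) * e (Suc k - j) \<alpha> * x j \<alpha>"
            by (simp add: e_def mult_ac del: binomial_Suc_Suc)
        qed
        have first: "(1 - \<alpha>) * x 1 \<alpha> = - \<alpha>" using elim nz by simp
        have "(1 - \<alpha>) / real (Suc k) * \<alpha> ^ l * r (Suc k) \<alpha>
            = \<alpha> ^ l * m k \<alpha> * ((1 - \<alpha>) * x 1 \<alpha>)
              + real k / 2 * (\<alpha> ^ l * m l \<alpha>) * ((1 - \<alpha>) * x 2 \<alpha>)
              + (1 - \<alpha>) / real (Suc k) * (\<alpha> ^ l * (\<Sum>j=3..Suc k. ?f j))"
          unfolding expanded[symmetric]
          by (simp add: field_simps del: binomial_Suc_Suc sum.cl_ivl_Suc of_nat_Suc)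
        also have "\<dots> = - e k \<alpha> + real k / 2 * e l \<alpha> * (2 * s \<alpha> + \<alpha>\<^sup>2 / (1 - \<alpha>))
              + (1 - \<alpha>) / real (Suc k) * rest \<alpha>"
          unfolding sum_eq first using elim by (simp add: e_def k)
        finally show ?case
          unfolding err_def by (simp add: algebra_simps del: of_nat_Suc)
      qed
    qed
    have err_g: "err \<in> O[at_right 0](g)"
    proof -
      have "(\<lambda>\<alpha>. real (Suc k choose j) * \<alpha> ^ (j - 2) * e (Suc k - j) \<alpha> * x j \<alpha>) \<in> O[at_right 0](g)"
        if "j \<in> {3..Suc k}" for j
      proof -
        have "(\<lambda>\<alpha>. real (Suc k choose j) * \<alpha> ^ (j - 2) * e (Suc k - j) \<alpha> * x j \<alpha>)
            \<in> O[at_right 0](\<lambda>\<alpha>. 1 * g \<alpha> * 1 * 1)"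
          using that by (intro landau_o.big.mult pow_g e_bdd x_bdd bigo_const) auto
        then show ?thesis by (simp only: mult_1_left mult_1_right)
      qed
      then have rest: "rest \<in> O[at_right 0](g)"
        unfolding rest_def[abs_def] by (intro big_sum_in_bigo)
      \<comment> \<open>For \<open>k = 1\<close> the prefactor \<open>\<alpha> ^ l\<close> is 1 and
        smallness must come from \<open>r2\<close>; this is where the logarithm enters. For larger
        \<open>k\<close> boundedness of \<open>r\<close> suffices.\<close>
      have rem: "(\<lambda>\<alpha>. \<alpha> ^ l * r (Suc k) \<alpha>) \<in> O[at_right 0](g)"
      proof (cases "l = 0")
        case True
        then show ?thesis using r2 k by (simp add: numeral_2_eq_2)
      next
        case False
        have "(\<lambda>\<alpha>. \<alpha> ^ l * r (Suc k) \<alpha>) \<in> O[at_right 0](\<lambda>\<alpha>. g \<alpha> * 1)"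
          using False by (intro landau_o.big.mult pow_g r_bdd) auto
        then show ?thesis by simp
      qed
      have "(\<lambda>\<alpha>. real k / 2 * (\<alpha>\<^sup>2 / (1 - \<alpha>))) \<in> O[at_right 0](g)"
        unfolding g_def by real_asymp
      then have "(\<lambda>\<alpha>. real k / 2 * (\<alpha>\<^sup>2 / (1 - \<alpha>)) * e l \<alpha>) \<in> O[at_right 0](\<lambda>\<alpha>. g \<alpha> * 1)"
        using k by (intro landau_o.big.mult e_bdd) auto
      moreover have "(\<lambda>\<alpha>. (1 - \<alpha>) / real (Suc k)) \<in> O[at_right 0](\<lambda>_. 1)"
        by real_asymp
      then have "(\<lambda>\<alpha>. (1 - \<alpha>) / real (Suc k) * (rest \<alpha> - \<alpha> ^ l * r (Suc k) \<alpha>))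
          \<in> O[at_right 0](\<lambda>\<alpha>. 1 * g \<alpha>)"
        by (intro landau_o.big.mult sum_in_bigo rest rem)
      ultimately show ?thesis unfolding err_def[abs_def] by (intro sum_in_bigo) auto
    qed
    \<comment> \<open>Since \<open>fact k * s ^ k = k * s * (fact l * s ^ l)\<close>, the error of
      order \<open>l\<close> is only multiplied by the bounded factor \<open>k * s\<close> before
      \<open>err\<close> is added.\<close>
    have "(\<lambda>\<alpha>. (real k * s \<alpha> ^ 1) * (e l \<alpha> - fact l * s \<alpha> ^ l)) \<in> O[at_right 0](\<lambda>\<alpha>. 1 * g \<alpha>)"
      using k by (intro landau_o.big.mult s_pow e_asymp) auto
    then have "(\<lambda>\<alpha>. (real k * s \<alpha> ^ 1) * (e l \<alpha> - fact l * s \<alpha> ^ l) + err \<alpha>) \<in> O[at_right 0](g)"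
      using err_g by (intro sum_in_bigo) auto
    moreover have "\<forall>\<^sub>F \<alpha> in at_right 0. \<alpha> ^ k * m k \<alpha> - fact k * s \<alpha> ^ k
        = (real k * s \<alpha> ^ 1) * (e l \<alpha> - fact l * s \<alpha> ^ l) + err \<alpha>"
      using rec by eventually_elim (simp add: e_def k algebra_simps)
    ultimately show ?thesis by (rule landau_o.big.in_cong[THEN iffD2, rotated])
  qed
qed

section \<open>From the queueing hypotheses to the Lindley setting\<close>

lemma mgf_analytic_on_strip_imp_integrable_exp:
  assumes "mgf_analytic_on_strip M X \<delta>" and "0 \<le> \<delta>"
  shows "integrable M (\<lambda>x. exp (\<delta> * X x))"
proof -
  obtain a b where "a < - \<delta>" "\<delta> < b"
    and int: "\<And>z. a < Re z \<Longrightarrow> Re z < b \<Longrightarrow> integrable M (\<lambda>x. exp (z * complex_of_real (X x)))"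
    using assms(1) unfolding mgf_analytic_on_strip_def by blast
  then have "integrable M (\<lambda>x. exp (complex_of_real \<delta> * complex_of_real (X x)))"
    using assms(2) by (intro int) auto
  from integrable_norm[OF this] show ?thesis by simp
qed

text \<open>Independence of \<open>V\<close> and \<open>T\<close> identifies the product of their
  laws with their joint law on \<open>M\<close>. Both are then evaluated at the same point of
  \<open>M\<close>, and only their difference remains in the recursion.\<close>

lemma steady_state_imp_lindley_stationary:
  assumes "prob_space M" and indep: "prob_space.indep_var M borel V borel T"
    and ss: "steady_state_waiting_time N W M V T"
  shows "lindley_stationary N M W (\<lambda>x. V x - T x)"
proof -
  interpret M: prob_space M by fact
  interpret N: prob_space N using ss by (simp add: steady_state_waiting_time_def)
  interpret P: pair_prob_space N M ..
  have [measurable]: "W \<in> borel_measurable N"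
    using ss by (simp add: steady_state_waiting_time_def)
  have [measurable]: "V \<in> borel_measurable M" "T \<in> borel_measurable M"
    using M.indep_var_rv1[OF indep] M.indep_var_rv2[OF indep] by auto
  have joint: "distr M borel V \<Otimes>\<^sub>M distr M borel T = distr M (borel \<Otimes>\<^sub>M borel) (\<lambda>x. (V x, T x))"
    using indep by (simp add: M.indep_var_distribution_eq)
  interpret VT: prob_space "distr M (borel \<Otimes>\<^sub>M borel) (\<lambda>x. (V x, T x))"
    by (rule M.prob_space_distr) measurable
  have "distr N borel W \<Otimes>\<^sub>M distr M (borel \<Otimes>\<^sub>M borel) (\<lambda>x. (V x, T x))
      = distr (N \<Otimes>\<^sub>M M) (borel \<Otimes>\<^sub>M (borel \<Otimes>\<^sub>M borel)) (\<lambda>(w, x). (W w, V x, T x))"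
    by (rule pair_measure_distr) (auto intro: VT.sigma_finite_measure_axioms)
  then have "distr N borel W = distr (distr (N \<Otimes>\<^sub>M M) (borel \<Otimes>\<^sub>M (borel \<Otimes>\<^sub>M borel))
      (\<lambda>(w, x). (W w, V x, T x))) borel (\<lambda>(w, v, t). max 0 (w + v - t))"
    using ss by (simp add: steady_state_waiting_time_def joint)
  also have "\<dots> = distr (N \<Otimes>\<^sub>M M) borel (\<lambda>z. max 0 (W (fst z) + (V (snd z) - T (snd z))))"
    by (subst distr_distr) (auto simp: comp_def case_prod_beta add_diff_eq)
  finally show ?thesis
    using ss by unfold_locales (auto simp: steady_state_waiting_time_def)
qed

section \<open>Estimates uniform in \<alpha> and the conclusion\<close>

theorem mainTheorem2:
  fixes M :: "'a measure" and V U :: "'a \<Rightarrow> real" and \<delta> :: real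
    and N :: "real \<Rightarrow> 'b measure" and W :: "real \<Rightarrow> 'b \<Rightarrow> real"
    and k :: nat
  assumes "prob_space M"
    and "prob_space.indep_var M borel V borel U"
    and "AE x in M. 0 \<le> V x" and "AE x in M. 0 \<le> U x"
    and "integrable M V" and "integrable M U"
    and "prob_space.expectation M V = 1" and "prob_space.expectation M U = 1"
    and "integrable M (\<lambda>x. (V x)\<^sup>2)" and "integrable M (\<lambda>x. (U x)\<^sup>2)"
    and "0 < prob_space.variance M V + prob_space.variance M U"
    and "0 < \<delta>"
    and "mgf_analytic_on_strip M V \<delta>" and "mgf_analytic_on_strip M U \<delta>"
    and "\<And>\<alpha>. 0 < \<alpha> \<Longrightarrow> \<alpha> < 1 \<Longrightarrow>
           steady_state_waiting_time (N \<alpha>) (W \<alpha>) M V (\<lambda>x. 1 / (1 - \<alpha>) * U x)"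
    and "1 \<le> k"
  shows "(\<forall>\<^sub>F \<alpha> in at_right 0. integrable (N \<alpha>) (\<lambda>x. (\<alpha> * W \<alpha> x) ^ k)) \<and>
         (\<lambda>\<alpha>. prob_space.expectation (N \<alpha>) (\<lambda>x. (\<alpha> * W \<alpha> x) ^ k)
               - fact k * (1 / 2 * sigma_sq M V U \<alpha>) ^ k)
           \<in> O[at_right 0](\<lambda>\<alpha>. \<alpha> * ln (1 / \<alpha>))"
proof -
  interpret M: prob_space M by fact
  have [measurable]: "V \<in> borel_measurable M" "U \<in> borel_measurable M"
    using assms(5,6) by auto
  define X where "X \<alpha> x = V x - 1 / (1 - \<alpha>) * U x" for \<alpha> x
  \<comment> \<open>The function \<open>B\<close> defined next dominates the increment for all
    \<open>\<alpha> < 1 / 2\<close>, since then \<open>1 / (1 - \<alpha>) < 2\<close>. For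
    nonnegative \<open>V\<close> and \<open>U\<close> it is at most four times their maximum, so
    \<open>\<eta> = \<delta> / 4\<close> keeps \<open>\<eta> * B\<close> below
    \<open>\<delta>\<close> times that maximum.\<close>
  define \<eta> where "\<eta> = \<delta> / 4"
  define B where "B x = \<bar>V x\<bar> + 2 * \<bar>U x\<bar>" for x
  define K where "K = M.expectation (\<lambda>x. exp (\<eta> * B x))"
  have eta: "0 < \<eta>" using assms(12) by (simp add: \<eta>_def)
  have [measurable]: "X \<alpha> \<in> borel_measurable M" for \<alpha> unfolding X_def[abs_def] by measurable
  have [measurable]: "B \<in> borel_measurable M" unfolding B_def[abs_def] by measurable
  have B_nonneg: "0 \<le> B x" for x by (simp add: B_def)
  have B_exp: "integrable M (\<lambda>x. exp (\<eta> * B x))"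
  proof (rule Bochner_Integration.integrable_bound)
    \<comment> \<open>The exponential of the maximum is at most the sum of the exponentials, which
      reduces the claim to the separate exponential moments of \<open>V\<close> and
      \<open>U\<close>.\<close>
    show "integrable M (\<lambda>x. exp (\<delta> * V x) + exp (\<delta> * U x))"
      using assms(12-14) by (intro Bochner_Integration.integrable_add mgf_analytic_on_strip_imp_integrable_exp) auto
    show "AE x in M. norm (exp (\<eta> * B x)) \<le> norm (exp (\<delta> * V x) + exp (\<delta> * U x))"
      using assms(3,4)
    proof eventually_elim
      case (elim x)
      have "\<eta> * B x \<le> \<delta> * max (V x) (U x)"
      proof -
        have "B x \<le> 4 * max (V x) (U x)" using elim by (auto simp: B_def)
        then show ?thesis using eta assms(12) by (simp add: \<eta>_def field_simps)
      qed
      then have "exp (\<eta> * B x) \<le> exp (\<delta> * max (V x) (U x))" by simp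
      also have "\<dots> \<le> exp (\<delta> * V x) + exp (\<delta> * U x)" by (auto simp: max_def)
      finally show ?case by simp
    qed
  qed simp
  have B_pow: "integrable M (\<lambda>x. B x ^ n)" for n
    using B_exp B_nonneg by (intro M.integrable_power_of_exp_abs[OF _ eta]) auto
  have XB: "\<bar>X \<alpha> x\<bar> \<le> B x" if "0 < \<alpha>" "\<alpha> < 1 / 2" for \<alpha> x
  proof -
    have "\<bar>1 / (1 - \<alpha>) * U x\<bar> \<le> 2 * \<bar>U x\<bar>"
      unfolding abs_mult using that by (intro mult_right_mono) (auto simp: field_simps)
    then show ?thesis unfolding X_def B_def by linarith
  qed
  have X_exp: "integrable M (\<lambda>x. exp (\<eta> * \<bar>X \<alpha> x\<bar>))" if "0 < \<alpha>" "\<alpha> < 1 / 2" for \<alpha>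
    by (rule Bochner_Integration.integrable_bound[OF B_exp]) (use XB[OF that] eta in auto)
  have X_abs_pow: "integrable M (\<lambda>x. \<bar>X \<alpha> x\<bar> ^ n)" "M.expectation (\<lambda>x. \<bar>X \<alpha> x\<bar> ^ n) \<le> M.expectation (\<lambda>x. B x ^ n)"
    if "0 < \<alpha>" "\<alpha> < 1 / 2" for \<alpha> n
  proof -
    show "integrable M (\<lambda>x. \<bar>X \<alpha> x\<bar> ^ n)"
      by (rule Bochner_Integration.integrable_bound[OF B_pow[of n]])
         (use XB[OF that] B_nonneg in \<open>auto simp: power_abs intro!: power_mono\<close>)
    then show "M.expectation (\<lambda>x. \<bar>X \<alpha> x\<bar> ^ n) \<le> M.expectation (\<lambda>x. B x ^ n)"
      using XB[OF that] by (intro integral_mono B_pow power_mono) auto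
  qed
  have X_mean: "M.expectation (X \<alpha>) = - \<alpha> / (1 - \<alpha>)" if "0 < \<alpha>" "\<alpha> < 1 / 2" for \<alpha>
  proof -
    have "M.expectation (X \<alpha>) = 1 - 1 / (1 - \<alpha>)"
      unfolding X_def using assms(5-8) by simp
    then show ?thesis using that by (simp add: field_simps)
  qed
  have VU: "integrable M (\<lambda>x. V x * U x)" "M.expectation (\<lambda>x. V x * U x) = 1"
    using M.indep_var_integrable[OF assms(2,5,6)] M.indep_var_lebesgue_integral[OF assms(2,5,6)] assms(7,8)
    by auto
  have X_second: "(1 - \<alpha>) * M.expectation (\<lambda>x. X \<alpha> x ^ 2) = sigma_sq M V U \<alpha> + \<alpha>\<^sup>2 / (1 - \<alpha>)"
    if "0 < \<alpha>" "\<alpha> < 1 / 2" for \<alpha>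
  proof -
    \<comment> \<open>The mean of \<open>X \<alpha>\<close> is \<open>1 - q\<close>, so its second
      moment is the variance plus \<open>(q - 1)\<^sup>2\<close>. The mixed term is evaluated by
      \<open>VU\<close>, which rests on independence.\<close>
    define q where "q = 1 / (1 - \<alpha>)"
    have q: "(1 - \<alpha>) * q = 1" using that by (simp add: q_def)
    have "M.expectation (\<lambda>x. X \<alpha> x ^ 2)
        = M.expectation (\<lambda>x. (V x)\<^sup>2 + q\<^sup>2 * (U x)\<^sup>2 - 2 * q * (V x * U x))"
      by (intro Bochner_Integration.integral_cong) (auto simp: X_def q_def[symmetric] power2_eq_square algebra_simps)
    also have "\<dots> = M.expectation (\<lambda>x. (V x)\<^sup>2) + q\<^sup>2 * M.expectation (\<lambda>x. (U x)\<^sup>2) - 2 * q"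
      using VU assms(9,10) by simp
    also have "\<dots> = M.variance V + q\<^sup>2 * M.variance U + (q - 1)\<^sup>2"
    proof -
      have "M.expectation (\<lambda>x. (V x)\<^sup>2) = M.variance V + 1" "M.expectation (\<lambda>x. (U x)\<^sup>2) = M.variance U + 1"
        using M.variance_eq[OF assms(5,9)] M.variance_eq[OF assms(6,10)] assms(7,8) by simp_all
      then show ?thesis by (simp only:) (simp add: power2_eq_square algebra_simps)
    qed
    finally have "(1 - \<alpha>) * M.expectation (\<lambda>x. X \<alpha> x ^ 2)
        = (M.variance V + q\<^sup>2 * M.variance U) * (1 - \<alpha>) + (1 - \<alpha>) * (q - 1)\<^sup>2"
      by (simp add: algebra_simps)
    also have "(1 - \<alpha>) * (q - 1)\<^sup>2 = \<alpha>\<^sup>2 / (1 - \<alpha>)"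
    proof -
      have "q - 1 = \<alpha> / (1 - \<alpha>)" using that by (simp add: q_def field_simps)
      then show ?thesis by (simp add: power2_eq_square)
    qed
    finally show ?thesis by (simp add: sigma_sq_def Let_def q_def)
  qed
  have lindley: "lindley_stationary (N \<alpha>) M (W \<alpha>) (X \<alpha>)" if "0 < \<alpha>" "\<alpha> < 1 / 2" for \<alpha>
  proof -
    have "M.indep_var borel (id \<circ> V) borel ((\<lambda>u. 1 / (1 - \<alpha>) * u) \<circ> U)"
      by (rule M.indep_var_compose[OF assms(2)]) auto
    then have "M.indep_var borel V borel (\<lambda>x. 1 / (1 - \<alpha>) * U x)"
      by (simp add: comp_def)
    from steady_state_imp_lindley_stationary[OF assms(1) this assms(15)] that show ?thesis
      by (simp add: X_def[abs_def])
  qed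
  have drift: "M.expectation (X \<alpha>) < 0" if "0 < \<alpha>" "\<alpha> < 1 / 2" for \<alpha>
    using X_mean[OF that] that by (simp add: divide_neg_pos)
  have small: "\<forall>\<^sub>F \<alpha>::real in at_right 0. 0 < \<alpha> \<and> \<alpha> < 1 / 2"
    by (rule eventually_at_rightI[of 0 "1 / 2"]) auto
  define m where "m j \<alpha> = (\<integral>w. W \<alpha> w ^ j \<partial>N \<alpha>)" for j \<alpha>
  define x where "x j \<alpha> = M.expectation (\<lambda>y. X \<alpha> y ^ j)" for j \<alpha>
  define r where "r n \<alpha> = (\<integral>z. (min 0 (W \<alpha> (fst z) + X \<alpha> (snd z))) ^ n \<partial>(N \<alpha> \<Otimes>\<^sub>M M))" for n \<alpha>
  have "(\<lambda>\<alpha>. \<alpha> ^ k * m k \<alpha> - fact k * (1 / 2 * sigma_sq M V U \<alpha>) ^ k)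
      \<in> O[at_right 0](\<lambda>\<alpha>. \<alpha> * ln (1 / \<alpha>))"
  proof (rule heavy_traffic_recurrence_asymp)
    show "\<forall>\<^sub>F \<alpha> in at_right 0. m 0 \<alpha> = 1"
      using small
    proof eventually_elim
      case (elim \<alpha>)
      interpret L: lindley_stationary "N \<alpha>" M "W \<alpha>" "X \<alpha>" using elim by (intro lindley) auto
      show ?case by (simp add: m_def L.N.prob_space)
    qed
    show "\<forall>\<^sub>F \<alpha> in at_right 0. x 1 \<alpha> = - \<alpha> / (1 - \<alpha>)"
      using small by eventually_elim (use X_mean in \<open>auto simp: x_def\<close>)
    show "\<forall>\<^sub>F \<alpha> in at_right 0. (1 - \<alpha>) * x 2 \<alpha> = 2 * (1 / 2 * sigma_sq M V U \<alpha>) + \<alpha>\<^sup>2 / (1 - \<alpha>)"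
      using small by eventually_elim (use X_second in \<open>auto simp: x_def\<close>)
    show "x j \<in> O[at_right 0](\<lambda>_. 1)" for j
    proof (rule bigoI)
      show "\<forall>\<^sub>F \<alpha> in at_right 0. norm (x j \<alpha>) \<le> M.expectation (\<lambda>y. B y ^ j) * norm (1::real)"
        using small
      proof eventually_elim
        case (elim \<alpha>)
        have "\<bar>x j \<alpha>\<bar> \<le> M.expectation (\<lambda>y. \<bar>X \<alpha> y\<bar> ^ j)"
          unfolding x_def power_abs[symmetric] by (rule integral_abs_bound)
        then show ?case using X_abs_pow(2)[of \<alpha> j] elim by simp
      qed
    qed
    show "r n \<in> O[at_right 0](\<lambda>_. 1)" for n
    proof (rule bigoI)
      show "\<forall>\<^sub>F \<alpha> in at_right 0. norm (r n \<alpha>) \<le> M.expectation (\<lambda>y. B y ^ n) * norm (1::real)"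
        using small
      proof eventually_elim
        case (elim \<alpha>)
        then have "lindley_stationary (N \<alpha>) M (W \<alpha>) (X \<alpha>)" by (intro lindley) auto
        from lindley_stationary.overshoot_moment_bound[OF this eta X_exp drift, of n]
        show ?case using X_abs_pow(2)[of \<alpha> n] elim by (simp add: r_def)
      qed
    qed
    show "r 2 \<in> O[at_right 0](\<lambda>\<alpha>. \<alpha> * ln (1 / \<alpha>))"
    proof -
      define u where "u \<alpha> = 2 / \<eta> * ln (1 / \<alpha>) * (\<alpha> / (1 - \<alpha>)) + 8 / \<eta>\<^sup>2 * \<alpha> * K" for \<alpha>
      have "\<forall>\<^sub>F \<alpha> in at_right 0. norm (r 2 \<alpha>) \<le> u \<alpha>"
        using small
      proof eventually_elim
        case (elim \<alpha>)
        then have \<alpha>: "0 < \<alpha>" "\<alpha> < 1 / 2" by auto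
        \<comment> \<open>This level balances the two terms of the overshoot estimate:
          \<open>exp (- (\<eta> * ?L / 2))\<close> equals \<alpha>, while \<open>?L\<close> times
          the mean idle time has order \<open>\<alpha> * ln (1 / \<alpha>)\<close>.\<close>
        let ?L = "2 / \<eta> * ln (1 / \<alpha>)"
        have L: "0 \<le> ?L" using \<alpha> eta by (intro mult_nonneg_nonneg) auto
        have "exp (- (\<eta> * ?L / 2)) = \<alpha>" using \<alpha> eta by (simp add: ln_div)
        with lindley_stationary.overshoot_second_moment_bound
          [OF lindley[OF \<alpha>] eta X_exp[OF \<alpha>] drift[OF \<alpha>] L]
        have "r 2 \<alpha> \<le> ?L * (\<alpha> / (1 - \<alpha>)) + 8 / \<eta>\<^sup>2 * \<alpha> * M.expectation (\<lambda>y. exp (\<eta> * \<bar>X \<alpha> y\<bar>))"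
          by (simp only: r_def X_mean[OF \<alpha>] minus_divide_left minus_minus)
        also have "\<dots> \<le> u \<alpha>"
          unfolding u_def K_def using \<alpha> eta XB[OF \<alpha>]
          by (intro add_left_mono mult_left_mono integral_mono X_exp[OF \<alpha>] B_exp) auto
        finally show ?case by (simp add: r_def)
      qed
      then have "r 2 \<in> O[at_right 0](u)" by (intro landau_o.big_mono) (auto elim: eventually_mono)
      moreover have "u \<in> O[at_right 0](\<lambda>\<alpha>. \<alpha> * ln (1 / \<alpha>))"
        unfolding u_def[abs_def] by real_asymp
      ultimately show ?thesis by (rule landau_o.big_trans)
    qed
    show "(\<lambda>\<alpha>. 1 / 2 * sigma_sq M V U \<alpha>) \<in> O[at_right 0](\<lambda>_. 1)"
    proof -
      \<comment> \<open>Because \<open>(1 / \<rho>)\<^sup>2 * \<rho> = 1 / \<rho>\<close>, half of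
        \<open>sigma_sq\<close> combines \<open>\<rho>\<close> and \<open>1 / \<rho>\<close> with
        constant coefficients, and both stay bounded as \<rho> tends to 1.\<close>
      let ?f = "\<lambda>\<alpha>::real. M.variance V / 2 * (1 - \<alpha>) + M.variance U / 2 * (1 / (1 - \<alpha>))"
      have "?f \<in> O[at_right 0](\<lambda>_. 1)"
        by (intro sum_in_bigo(1) landau_o.big.mult_in_1 bigo_const; real_asymp)
      moreover have "\<forall>\<^sub>F \<alpha> in at_right 0. 1 / 2 * sigma_sq M V U \<alpha> = ?f \<alpha>"
        using small
      proof eventually_elim
        case (elim \<alpha>)
        then have sq: "(1 / (1 - \<alpha>))\<^sup>2 * (1 - \<alpha>) = 1 / (1 - \<alpha>)"
          by (simp add: power2_eq_square)
        have "1 / 2 * ((v + q * u) * p) = v / 2 * p + u / 2 * (q * p)" for v q u p :: real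
          by (simp add: algebra_simps)
        then have "1 / 2 * sigma_sq M V U \<alpha>
            = M.variance V / 2 * (1 - \<alpha>) + M.variance U / 2 * ((1 / (1 - \<alpha>))\<^sup>2 * (1 - \<alpha>))"
          unfolding sigma_sq_def Let_def .
        then show ?case unfolding sq .
      qed
      ultimately show ?thesis by (rule landau_o.big.in_cong[THEN iffD2, rotated])
    qed
    show "\<forall>\<^sub>F \<alpha> in at_right 0. (\<Sum>j=1..n. real (n choose j) * m (n - j) \<alpha> * x j \<alpha>) = r n \<alpha>"
      if "1 \<le> n" for n
      using small
    proof eventually_elim
      case (elim \<alpha>)
      then have \<alpha>: "0 < \<alpha>" "\<alpha> < 1 / 2" by auto
      show ?case
        using lindley_stationary.moment_identity[OF lindley[OF \<alpha>] eta X_exp[OF \<alpha>] drift[OF \<alpha>] that]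
        by (simp add: m_def x_def r_def)
    qed
  qed
  \<comment> \<open>The Bochner integral is 0 by default, so integrability has to accompany the
    asymptotics for the expectation to be a genuine moment.\<close>
  moreover have "\<forall>\<^sub>F \<alpha> in at_right 0. integrable (N \<alpha>) (\<lambda>x. (\<alpha> * W \<alpha> x) ^ k)"
    using small
  proof eventually_elim
    case (elim \<alpha>)
    then have \<alpha>: "0 < \<alpha>" "\<alpha> < 1 / 2" by auto
    show ?case
      using lindley_stationary.integrable_W_power[OF lindley[OF \<alpha>] eta X_exp[OF \<alpha>] drift[OF \<alpha>]]
      by (simp add: power_mult_distrib)
  qed
  ultimately show ?thesis by (simp add: m_def power_mult_distrib)
qed

end
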